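(* Let $G$ be a digraph on the vertex set $[m]$ and let $(G,P)$ be a run network. Let $\{w_a^{(i,j)} : (a,(i,j))\in P\}$ be a set of weights from $A$, and set $w_a^{(i,j)}=0$ whenever $(a,(i,j))\notin P$. For a composition $L=(L_1,\dots,L_k)$ and $1\le i,j\le m$, let $w^{(i,j)}(L)=w_{L_1}^{e_1}\cdots w_{L_k}^{e_k}$ if there exists $\alpha=(L_1,e_1)\cdots(L_k,e_k)\in\overrightarrow{P^*}$ with $E(\alpha)=(i,j)$ and $\rho(\alpha)=L$, and let $w^{(i,j)}(L)=0$ otherwise. Define elements $v_n^{(i,j)}\in A$ ($n\ge 0$, $1\le i,j\le m$) by the identity of $m\times m$ matrices of formal power series in $x$ over $A$ $$\Big[\sum_{n\ge0} v_n^{(i,j)}x^n\Big]_{i,j=1}^m=\Big(I_m+\Big[\sum_{k\ge1} w_k^{(i,j)}x^k\Big]_{i,j=1}^m\Big)^{-1}.$$ Then, in the algebra of $m\times m$ matrices over $A\otimes_F\mathbf{Sym}$, $$\Big[\sum_{L} w^{(i,j)}(L)\,\mathbf r_L\Big]_{i,j=1}^m=\Big[\sum_{n\ge0} v_n^{(i,j)}\mathbf h_n\Big]_{i,j=1}^m{}^{-1},$$ where each sum on the left is over all compositions $L$.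
   Context: $F$ is a field of characteristic zero and $A$ is a unital $F$-algebra (not necessarily commutative); elements of $A$ commute with the noncommuting indeterminates $X_1,X_2,\dots$ (one works in $A\otimes_F\mathbf{Sym}$). In $F\langle\langle X_1,X_2,\dots\rangle\rangle$ let $\mathbf h_n=\sum_{i_1\le\cdots\le i_n}X_{i_1}\cdots X_{i_n}$ ($\mathbf h_0=1$), and $\mathbf{Sym}$ the subalgebra generated by the $\mathbf h_n$. For a composition $L=(L_1,\dots,L_k)$ of $n$, $\mathbf r_L=\sum X_{i_1}\cdots X_{i_n}$ over all $(i_1,\dots,i_n)$ with $i_1\le\cdots\le i_{L_1}>i_{L_1+1}\le\cdots\le i_{L_1+L_2}>\cdots>i_{L_1+\cdots+L_{k-1}+1}\le\cdots\le i_n$ (the generating function of words over the positive integers whose maximal weakly increasing runs have lengths $L_1,\dots,L_k$). For the empty composition, $\mathbf r_\emptyset=1$ and $w^{(i,j)}(\emptyset)=\delta_{ij}$. Run network: $G$ is a digraph on $[m]$ in which each arc $(i,j)$ is assigned a nonempty subset $P_{i,j}$ of the positive integers; $P$ is the set of pairs $(a,e)$ with $e=(i,j)$ an arc and $a\in P_{i,j}$. $\overrightarrow{P^*}$ is the set of finite sequences $\alpha=(a_1,e_1)\cdots(a_n,e_n)$ of elements of $P$ such that $e_1e_2\cdots e_n$ is a walk in $G$; $\rho(\alpha)=(a_1,\dots,a_n)$ and $E(\alpha)=(i,j)$ where $i,j$ are the initial and terminal vertices of the walk. $(G,P)$ is a run network if for all nonempty $\alpha,\beta\in\overrightarrow{P^*}$,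 $\rho(\alpha)=\rho(\beta)$ and $E(\alpha)=E(\beta)$ imply $\alpha=\beta$. *)

theory Defs
  imports
    "HOL-Analysis.Cartesian_Space"
    "HOL-Computational_Algebra.Formal_Power_Series"
    "Graph_Theory.Pair_Digraph"
begin

section \<open>Formal power series in noncommuting indeterminates\<close>

text \<open>
  A word \<open>[i\<^sub>1, \<dots>, i\<^sub>n]\<close> stands for the monomial
  \<open>X\<^sub>i\<^sub>1 \<cdots> X\<^sub>i\<^sub>n\<close>.  Letters are natural numbers, letter \<open>i\<close> being the
  indeterminate usually written with index \<open>i + 1\<close>; only the order of the indices matters.
  The coefficients commute with the indeterminates but not necessarily with each other.
\<close>

typedef 'a ncfps = "UNIV :: (nat list \<Rightarrow> 'a) set"
  morphisms nc_coeff Abs_ncfps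
  by simp

setup_lifting type_definition_ncfps

lemma ncfps_eq_iff: "f = g \<longleftrightarrow> (\<forall>u. nc_coeff f u = nc_coeff g u)"
  by (metis ext nc_coeff_inject)

lemma nc_coeff_Abs [simp]: "nc_coeff (Abs_ncfps c) = c"
  by (simp add: Abs_ncfps_inverse)

instantiation ncfps :: (ring_1) ring_1
begin

lift_definition zero_ncfps :: "'a ncfps" is "\<lambda>_. 0" .
lift_definition one_ncfps :: "'a ncfps" is "\<lambda>u. if u = [] then 1 else 0" .
lift_definition plus_ncfps :: "'a ncfps \<Rightarrow> 'a ncfps \<Rightarrow> 'a ncfps" is "\<lambda>f g u. f u + g u" .
lift_definition minus_ncfps :: "'a ncfps \<Rightarrow> 'a ncfps \<Rightarrow> 'a ncfps" is "\<lambda>f g u. f u - g u" .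
lift_definition uminus_ncfps :: "'a ncfps \<Rightarrow> 'a ncfps" is "\<lambda>f u. - f u" .
lift_definition times_ncfps :: "'a ncfps \<Rightarrow> 'a ncfps \<Rightarrow> 'a ncfps"
  is "\<lambda>f g u. \<Sum>k=0..length u. f (take k u) * g (drop k u)" .

instance
proof
  fix a b c :: "'a ncfps"
  show "a + b + c = a + (b + c)" by transfer (simp add: add.assoc)
  show "a + b = b + a" by transfer (simp add: add.commute)
  show "0 + a = a" by transfer simp
  show "- a + a = 0" by transfer simp
  show "a - b = a + - b" by transfer simp
  show "(a + b) * c = a * c + b * c"
    by transfer (simp add: distrib_right sum.distrib)
  show "a * (b + c) = a * b + a * c"
    by transfer (simp add: distrib_left sum.distrib)
  show "(0 :: 'a ncfps) \<noteq> 1" by transfer (metis zero_neq_one)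
  show "1 * a = a"
  proof (transfer, rule ext)
    fix a :: "nat list \<Rightarrow> 'a" and u
    have "(\<Sum>k=0..length u. (if take k u = [] then 1 else 0) * a (drop k u)) =
          (\<Sum>k=0..length u. if k = 0 then a u else 0)"
      by (intro sum.cong) auto
    also have "\<dots> = a u" by simp
    finally show "(\<Sum>k=0..length u. (if take k u = [] then 1 else 0) * a (drop k u)) = a u" .
  qed
  show "a * 1 = a"
  proof (transfer, rule ext)
    fix a :: "nat list \<Rightarrow> 'a" and u
    have "(\<Sum>k=0..length u. a (take k u) * (if drop k u = [] then 1 else 0)) =
          (\<Sum>k=0..length u. if k = length u then a u else 0)"
      by (intro sum.cong) auto
    also have "\<dots> = a u" by simp
    finally show "(\<Sum>k=0..length u. a (take k u) * (if drop k u = [] then 1 else 0)) = a u" .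
  qed
  show "a * b * c = a * (b * c)"
  proof (transfer, rule ext)
    fix a b c :: "nat list \<Rightarrow> 'a" and u :: "nat list"
    let ?F = "\<lambda>p q r. a (take p u) * b (take q (drop p u)) * c (drop (length u - r) u)"
    have "(\<Sum>k=0..length u. (\<Sum>j=0..length (take k u).
             a (take j (take k u)) * b (drop j (take k u))) * c (drop k u)) =
          (\<Sum>k=0..length u. \<Sum>j=0..k. ?F j (k - j) (length u - k))"
    proof (rule sum.cong)
      fix k assume "k \<in> {0..length u}"
      then have "length u - (length u - k) = k" "length (take k u) = k" by auto
      then show "(\<Sum>j=0..length (take k u).
             a (take j (take k u)) * b (drop j (take k u))) * c (drop k u) =
          (\<Sum>j=0..k. ?F j (k - j) (length u - k))"
        by (auto simp: sum_distrib_right drop_take min_absorb1 intro!: sum.cong)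
    qed simp
    also have "\<dots> = (\<Sum>j=0..length u. \<Sum>k=0..length u - j. ?F j k (length u - j - k))"
      by (rule fps_mult_assoc_lemma)
    also have "\<dots> = (\<Sum>j=0..length u. a (take j u) *
        (\<Sum>k=0..length (drop j u). b (take k (drop j u)) * c (drop k (drop j u))))"
    proof (rule sum.cong)
      fix j assume j: "j \<in> {0..length u}"
      have "length u - (length u - j - k) = j + k" if "k \<in> {0..length u - j}" for k
        using that j by auto
      then show "(\<Sum>k=0..length u - j. ?F j k (length u - j - k)) = a (take j u) *
        (\<Sum>k=0..length (drop j u). b (take k (drop j u)) * c (drop k (drop j u)))"
        by (auto simp: sum_distrib_left mult.assoc add.commute intro!: sum.cong)
    qed simp
    finally show "(\<Sum>k=0..length u. (\<Sum>j=0..length (take k u).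
             a (take j (take k u)) * b (drop j (take k u))) * c (drop k u)) =
        (\<Sum>j=0..length u. a (take j u) *
        (\<Sum>k=0..length (drop j u). b (take k (drop j u)) * c (drop k (drop j u))))" .
  qed
qed

end

text \<open>
  The sum of a possibly infinite family of series.  It is meaningful for families in which
  every word occurs with nonzero coefficient in only finitely many members.
\<close>

definition nc_summable :: "('i \<Rightarrow> 'a::ring_1 ncfps) \<Rightarrow> 'i set \<Rightarrow> bool" where
  "nc_summable g I \<longleftrightarrow> (\<forall>u. finite {i \<in> I. nc_coeff (g i) u \<noteq> 0})"

definition nc_sum :: "('i \<Rightarrow> 'a::ring_1 ncfps) \<Rightarrow> 'i set \<Rightarrow> 'a ncfps" where
  "nc_sum g I = Abs_ncfps (\<lambda>u. \<Sum>i \<in> {i \<in> I. nc_coeff (g i) u \<noteq> 0}. nc_coeff (g i) u)"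

definition nc_homogeneous_part :: "nat \<Rightarrow> 'a::ring_1 ncfps \<Rightarrow> 'a ncfps" where
  "nc_homogeneous_part n f = Abs_ncfps (\<lambda>u. if length u = n then nc_coeff f u else 0)"


section \<open>Noncommutative symmetric functions\<close>

definition nc_h :: "nat \<Rightarrow> 'f::field ncfps" where
  "nc_h n = Abs_ncfps (\<lambda>u. if length u = n \<and> sorted u then 1 else 0)"

inductive_set Sym :: "'f::field ncfps set" where
  Sym_one: "1 \<in> Sym"
| Sym_h: "nc_h n \<in> Sym"
| Sym_add: "s \<in> Sym \<Longrightarrow> t \<in> Sym \<Longrightarrow> s + t \<in> Sym"
| Sym_mult: "s \<in> Sym \<Longrightarrow> t \<in> Sym \<Longrightarrow> s * t \<in> Sym"
| Sym_scale: "s \<in> Sym \<Longrightarrow> Abs_ncfps (\<lambda>u. c * nc_coeff s u) \<in> Sym"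

definition compositions :: "nat list set" where
  "compositions = {L. \<forall>l \<in> set L. 0 < l}"

text \<open>The positions \<open>L\<^sub>1 + \<cdots> + L\<^sub>j\<close>, \<open>1 \<le> j < k\<close>, at which a run is followed by a descent.\<close>

definition descent_positions :: "nat list \<Rightarrow> nat set" where
  "descent_positions L = {sum_list (take j L) | j. 1 \<le> j \<and> j < length L}"

text \<open>Positions \<open>p\<close> are counted from 1, hence the shift in the list indices.\<close>

definition has_run_lengths :: "nat list \<Rightarrow> nat list \<Rightarrow> bool" where
  "has_run_lengths u L \<longleftrightarrow> length u = sum_list L \<and>
     (\<forall>p. 1 \<le> p \<and> p < length u \<longrightarrow>
        (if p \<in> descent_positions L then u ! (p - 1) > u ! p else u ! (p - 1) \<le> u ! p))"

definition nc_r :: "nat list \<Rightarrow> 'f::field ncfps" where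
  "nc_r L = Abs_ncfps (\<lambda>u. if has_run_lengths u L then 1 else 0)"


section \<open>Extension of scalars\<close>

locale unital_algebra = vector_space smul
  for smul :: "'f::field \<Rightarrow> 'a::ring_1 \<Rightarrow> 'a" +
  assumes scale_mult_left: "smul c a * b = smul c (a * b)"
    and scale_mult_right: "a * smul c b = smul c (a * b)"

text \<open>
  The pure tensor \<open>a \<otimes> s\<close>.  The tensor product of \<open>A\<close> with the series over the field \<open>F\<close>
  embeds into the series over \<open>A\<close>, and this is the image of \<open>a \<otimes> s\<close> under that embedding.
\<close>

definition nc_tensor :: "('f::field \<Rightarrow> 'a::ring_1 \<Rightarrow> 'a) \<Rightarrow> 'a \<Rightarrow> 'f ncfps \<Rightarrow> 'a ncfps" where
  "nc_tensor smul a s = Abs_ncfps (\<lambda>u. smul (nc_coeff s u) a)"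

definition tensor_Sym :: "('f::field \<Rightarrow> 'a::ring_1 \<Rightarrow> 'a) \<Rightarrow> 'a ncfps set" where
  "tensor_Sym smul =
     {\<Sum>(a, s)\<leftarrow>ps. nc_tensor smul a s | ps. \<forall>(a, s) \<in> set ps. s \<in> Sym}"

text \<open>
  The completion of \<open>A \<otimes> Sym\<close> with respect to the degree: infinite sums of homogeneous elements
  of increasing degree are admitted.
\<close>

definition completed_tensor_Sym :: "('f::field \<Rightarrow> 'a::ring_1 \<Rightarrow> 'a) \<Rightarrow> 'a ncfps set" where
  "completed_tensor_Sym smul = {f. \<forall>n. nc_homogeneous_part n f \<in> tensor_Sym smul}"

lemma (in unital_algebra) nc_tensor_mult:
  "nc_tensor smul a s * nc_tensor smul b t = nc_tensor smul (a * b) (s * t)"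
proof -
  have "smul c a * smul d b = smul (c * d) (a * b)" for c d
    by (simp only: scale_mult_left scale_mult_right scale_scale mult.commute[of d c])
  then show ?thesis
    by (simp add: ncfps_eq_iff nc_tensor_def times_ncfps.rep_eq scale_sum_left)
qed

lemma (in unital_algebra) nc_summable_nc_h:
  "nc_summable (\<lambda>n. nc_tensor smul (a n) (nc_h n)) UNIV"
  unfolding nc_summable_def
proof
  fix u :: "nat list"
  have "{n \<in> UNIV. nc_coeff (nc_tensor smul (a n) (nc_h n)) u \<noteq> 0} \<subseteq> {length u}"
    by (auto simp: nc_tensor_def nc_h_def split: if_splits)
  then show "finite {n \<in> UNIV. nc_coeff (nc_tensor smul (a n) (nc_h n)) u \<noteq> 0}"
    using finite_subset by blast
qed

lemma finite_compositions: "finite {L \<in> compositions. sum_list L = n}"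
proof (rule finite_subset)
  have "length L \<le> sum_list L" if "\<forall>l \<in> set L. 0 < l" for L :: "nat list"
    using that by (induction L) auto
  then show "{L \<in> compositions. sum_list L = n} \<subseteq> {L. set L \<subseteq> {..n} \<and> length L \<le> n}"
    using member_le_sum_list by (fastforce simp: compositions_def)
  show "finite {L. set L \<subseteq> {..n} \<and> length L \<le> n}"
    by (rule finite_lists_length_le) simp
qed

lemma (in unital_algebra) nc_summable_nc_r:
  "nc_summable (\<lambda>L. nc_tensor smul (a L) (nc_r L)) compositions"
  unfolding nc_summable_def
proof
  fix u :: "nat list"
  have "{L \<in> compositions. nc_coeff (nc_tensor smul (a L) (nc_r L)) u \<noteq> 0} \<subseteq>
        {L \<in> compositions. sum_list L = length u}"
    by (auto simp: nc_tensor_def nc_r_def has_run_lengths_def split: if_splits)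
  then show "finite {L \<in> compositions. nc_coeff (nc_tensor smul (a L) (nc_r L)) u \<noteq> 0}"
    using finite_compositions finite_subset by blast
qed


section \<open>Run networks\<close>

text \<open>\<open>P e\<close> is the set assigned to the arc \<open>e\<close>; its value at non-arcs is irrelevant.\<close>

definition labelled_arcs ::
    "'v pair_pre_digraph \<Rightarrow> ('v \<times> 'v \<Rightarrow> nat set) \<Rightarrow> (nat \<times> 'v \<times> 'v) set" where
  "labelled_arcs G P = {(a, e). e \<in> parcs G \<and> a \<in> P e}"

text \<open>
  The sequences \<open>\<alpha>\<close> whose underlying walk leads from \<open>i\<close> to \<open>j\<close>.  The label sequence of
  \<open>\<alpha>\<close> is \<open>map fst \<alpha>\<close>.  The empty sequence belongs to \<open>labelled_walks G P i j\<close> iff \<open>i = j\<close>.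
\<close>

definition labelled_walks :: "'v pair_pre_digraph \<Rightarrow> ('v \<times> 'v \<Rightarrow> nat set) \<Rightarrow>
    'v \<Rightarrow> 'v \<Rightarrow> (nat \<times> 'v \<times> 'v) list set" where
  "labelled_walks G P i j =
     {\<alpha>. set \<alpha> \<subseteq> labelled_arcs G P \<and> pre_digraph.awalk (with_proj G) i (map snd \<alpha>) j}"

locale run_network = pair_wf_digraph G
  for G :: "'v::finite pair_pre_digraph" +
  fixes P :: "'v \<times> 'v \<Rightarrow> nat set"
  assumes verts_UNIV: "pverts G = UNIV"
    and labels_nonempty: "e \<in> parcs G \<Longrightarrow> P e \<noteq> {}"
    and labels_pos: "e \<in> parcs G \<Longrightarrow> a \<in> P e \<Longrightarrow> 0 < a"
    and labels_determine_walk: "\<alpha> \<noteq> [] \<Longrightarrow> \<beta> \<noteq> [] \<Longrightarrow>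
      \<alpha> \<in> labelled_walks G P i j \<Longrightarrow> \<beta> \<in> labelled_walks G P i j \<Longrightarrow>
      map fst \<alpha> = map fst \<beta> \<Longrightarrow> \<alpha> = \<beta>"

definition run_weight :: "'v pair_pre_digraph \<Rightarrow> ('v \<times> 'v \<Rightarrow> nat set) \<Rightarrow>
    (nat \<Rightarrow> 'v \<times> 'v \<Rightarrow> 'a::ring_1) \<Rightarrow> 'v \<Rightarrow> 'v \<Rightarrow> nat list \<Rightarrow> 'a" where
  "run_weight G P w i j L =
     (if \<exists>\<alpha> \<in> labelled_walks G P i j. map fst \<alpha> = L
      then \<Prod>(a, e)\<leftarrow>(THE \<alpha>. \<alpha> \<in> labelled_walks G P i j \<and> map fst \<alpha> = L). w a e
      else 0)"

lemma (in run_network) run_weight_Nil: "run_weight G P w i j [] = (if i = j then 1 else 0)"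
proof -
  have nil: "[] \<in> labelled_walks G P i j \<longleftrightarrow> i = j"
    by (simp add: labelled_walks_def verts_UNIV awalk_Nil_iff)
  show ?thesis
  proof (cases "i = j")
    case True
    then have "(THE \<alpha>. \<alpha> \<in> labelled_walks G P i j \<and> \<alpha> = []) = []"
      using nil by (intro the_equality) auto
    then show ?thesis using nil True by (simp add: run_weight_def)
  next
    case False
    then show ?thesis using nil by (auto simp: run_weight_def)
  qed
qed

end

theory Submission
  imports Defs
begin

text \<open>
  Both matrices are compared coefficientwise.  The coefficient of \<open>H\<close> at a word \<open>u\<close> is the matrix
  \<open>V\<^sub>n\<close> if \<open>u\<close> is weakly increasing of length \<open>n\<close>, and zero otherwise.  In a run network a walk is
  determined by its labels and its ends, so the coefficient of \<open>R\<close> at \<open>u\<close> is the matrix product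
  \<open>W\<^sub>L\<^sub>1 \<cdots> W\<^sub>L\<^sub>k\<close>, where \<open>L\<close> lists the run lengths of \<open>u\<close>.  If \<open>a\<close> is the first run length of
  a nonempty \<open>u\<close>, then only the prefixes of length at most \<open>a\<close> contribute to the coefficient of
  \<open>H R\<close> at \<open>u\<close>, which therefore is \<open>V\<^sub>a + V\<^bsub>a-1\<^esub> W\<^sub>1 + \<cdots> + V\<^sub>0 W\<^sub>a = 0\<close> times a common right factor.
  Membership of the ribbon series in \<open>Sym\<close> comes from
  \<open>h\<^sub>a r\<^bsub>(b, L)\<^esub> = r\<^bsub>(a, b, L)\<^esub> + r\<^bsub>(a + b, L)\<^esub>\<close>.
\<close>

section \<open>Run lengths of words\<close>

text \<open>\<open>has_run_lengths\<close> only tests a given composition; computing it lets a sum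
  over all compositions collapse to one term at each word.\<close>

fun run_lengths :: "'a::linorder list \<Rightarrow> nat list" where
  "run_lengths [] = []"
| "run_lengths [x] = [1]"
| "run_lengths (x # y # u) =
     (if x \<le> y then Suc (hd (run_lengths (y # u))) # tl (run_lengths (y # u))
      else 1 # run_lengths (y # u))"

lemma run_lengths_eq_Nil_iff [simp]: "run_lengths u = [] \<longleftrightarrow> u = []"
  by (cases u rule: run_lengths.cases) auto

lemma sum_list_run_lengths: "sum_list (run_lengths u) = length u"
proof (induction u rule: run_lengths.induct)
  case (3 x y u)
  then show ?case by (cases "run_lengths (y # u)") auto
qed auto

lemma run_lengths_in_compositions: "run_lengths u \<in> compositions"
proof (induction u rule: run_lengths.induct)
  case (3 x y u)
  then show ?case
    by (cases "run_lengths (y # u)") (auto simp: compositions_def simp del: run_lengths_eq_Nil_iff)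
qed (auto simp: compositions_def)

text \<open>A cut inside the first run only shortens that run. At \<open>k = a\<close> nothing of it
  remains, and the result is \<open>L\<close> rather than \<open>0 # L\<close>, which is no
  composition.\<close>

lemma run_lengths_drop:
  assumes "run_lengths u = a # L" "k \<le> a"
  shows "run_lengths (drop k u) = (if k = a then L else (a - k) # L)"
  using assms
proof (induction u arbitrary: a L k rule: run_lengths.induct)
  case (3 x y u)
  obtain b C where bC: "run_lengths (y # u) = b # C"
    by (cases "run_lengths (y # u)") auto
  show ?case
    using 3 bC by (cases k) (auto split: if_splits)
qed (auto split: if_splits simp: le_Suc_eq)

text \<open>A prefix longer than the first run contains the first descent.\<close>

lemma sorted_take_iff_run_lengths:
  assumes "run_lengths u = a # L" "k \<le> length u"
  shows "sorted (take k u) \<longleftrightarrow> k \<le> a"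
  using assms
proof (induction u arbitrary: a L k rule: run_lengths.induct)
  case (3 x y u)
  obtain b C where bC: "run_lengths (y # u) = b # C"
    by (cases "run_lengths (y # u)") auto
  have b: "b > 0"
    using run_lengths_in_compositions[of "y # u"] unfolding bC by (simp add: compositions_def)
  \<comment> \<open>Prefixes with fewer than two letters are always sorted, and \<open>a > 0\<close>
    makes the right side true as well; only longer ones compare \<open>x\<close> with
    \<open>y\<close>.\<close>
  show ?case
  proof (cases "k < 2")
    case True
    then have "k = 0 \<or> k = 1" by auto
    moreover have "a > 0"
      using run_lengths_in_compositions[of "x # y # u"] "3.prems"(1)
      by (simp add: compositions_def del: run_lengths.simps)
    ultimately show ?thesis by auto
  next
    case False
    then obtain l where l: "k = Suc (Suc l)"
      by (metis add_2_eq_Suc le_Suc_ex not_less)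
    have "sorted (take (Suc l) (y # u)) \<longleftrightarrow> Suc l \<le> b"
      using "3.IH"(1,3)[OF _ bC, of "Suc l"] "3.prems" l by (cases "x \<le> y") auto
    moreover have "sorted (take k (x # y # u)) \<longleftrightarrow> x \<le> y \<and> sorted (take (Suc l) (y # u))"
      unfolding l by auto
    ultimately show ?thesis using "3.prems"(1) bC l by (auto split: if_splits)
  qed
qed auto

lemma descent_positions_Cons:
  "descent_positions (l # L) =
     (if L = [] then {} else insert l ((+) l ` descent_positions L))"
proof (cases "L = []")
  case False
  have "descent_positions (l # L) = (\<lambda>j. sum_list (take j (l # L))) ` {1..<Suc (length L)}"
    by (auto simp: descent_positions_def)
  also have "{1..<Suc (length L)} = Suc ` {0..<length L}"
    by (simp only: image_Suc_atLeastLessThan One_nat_def)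
  \<comment> \<open>The index 0 yields the end \<open>l\<close> of the first run; the others yield
    the descents of the rest, shifted by \<open>l\<close>.\<close>
  also have "{0..<length L} = insert 0 {1..<length L}" using False by auto
  also have "(\<lambda>j. sum_list (take j (l # L))) ` Suc ` insert 0 {1..<length L} =
      insert l ((+) l ` (\<lambda>j. sum_list (take j L)) ` {1..<length L})"
    by (simp add: image_image del: image_Suc_atLeastLessThan)
  also have "(\<lambda>j. sum_list (take j L)) ` {1..<length L} = descent_positions L"
    by (auto simp: descent_positions_def)
  finally show ?thesis using False by simp
qed (auto simp: descent_positions_def)

lemma descent_positions_pos: "L \<in> compositions \<Longrightarrow> p \<in> descent_positions L \<Longrightarrow> 0 < p"
  by (induction L)
    (auto simp: compositions_def descent_positions_Cons split: if_splits,
      auto simp: descent_positions_def)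

text \<open>Prepares an induction on the word: position 1 is split off, and the later positions are
  renumbered from the start of \<open>y # u\<close>.\<close>

lemma has_run_lengths_Cons_Cons:
  "has_run_lengths (x # y # u) L \<longleftrightarrow> Suc (Suc (length u)) = sum_list L \<and>
     (if 1 \<in> descent_positions L then x > y else x \<le> y) \<and>
     (\<forall>p. 1 \<le> p \<and> p < length (y # u) \<longrightarrow>
        (if Suc p \<in> descent_positions L then (y # u) ! (p - 1) > (y # u) ! p
         else (y # u) ! (p - 1) \<le> (y # u) ! p))" (is "?l \<longleftrightarrow> ?n \<and> ?a \<and> ?b")
proof -
  have split: "(\<forall>p. 1 \<le> p \<and> p < Suc n \<longrightarrow> Q p) \<longleftrightarrow>
      (0 < n \<longrightarrow> Q 1) \<and> (\<forall>p. 1 \<le> p \<and> p < n \<longrightarrow> Q (Suc p))" for n and Q :: "nat \<Rightarrow> bool"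
  proof (intro iffI conjI allI impI)
    fix p assume *: "(0 < n \<longrightarrow> Q 1) \<and> (\<forall>p. 1 \<le> p \<and> p < n \<longrightarrow> Q (Suc p))" "1 \<le> p \<and> p < Suc n"
    show "Q p"
    proof (cases "p = 1")
      case False
      with * obtain q where "p = Suc q" "1 \<le> q" "q < n" by (cases p) auto
      then show ?thesis using * by blast
    qed (use * in auto)
  qed auto
  have nth: "(x # y # u) ! (Suc p - 1) = (y # u) ! (p - 1) \<and> (x # y # u) ! Suc p = (y # u) ! p"
    if "1 \<le> p" for p
    using that by (cases p) auto
  show ?thesis
    unfolding has_run_lengths_def list.size split[of "length u + Suc 0"] add_Suc_right add_0_right
      split[of "Suc (length u)"]
    using nth by simp
qed

lemma has_run_lengths_step:
  assumes "l # L \<in> compositions"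
  shows "has_run_lengths (x # y # u) (l # L) \<longleftrightarrow>
    (if l = 1 then L \<noteq> [] \<and> x > y \<and> has_run_lengths (y # u) L
     else x \<le> y \<and> has_run_lengths (y # u) ((l - 1) # L))"
proof -
  have pos: "0 < p" if "p \<in> descent_positions L" for p
    using assms that descent_positions_pos[of L p] by (auto simp: compositions_def)
  have "0 < l" using assms by (simp add: compositions_def)
  then consider "l = 1" | m where "l = Suc m" "m > 0" by (cases l) auto
  then show ?thesis
  proof cases
    case 1
    have "Suc p \<in> descent_positions (1 # L) \<longleftrightarrow> p \<in> descent_positions L" if "1 \<le> p" for p
      using that by (cases "L = []") (auto simp: descent_positions_Cons descent_positions_def[of "[]"])
    moreover have "1 \<in> descent_positions (1 # L) \<longleftrightarrow> L \<noteq> []"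
      by (auto simp: descent_positions_Cons)
    ultimately show ?thesis
      unfolding has_run_lengths_Cons_Cons 1 by (auto simp: has_run_lengths_def)
  next
    case 2
    have "Suc p \<in> descent_positions (Suc m # L) \<longleftrightarrow> p \<in> descent_positions (m # L)" for p
      by (auto simp: descent_positions_Cons)
    moreover have "1 \<notin> descent_positions (Suc m # L)"
      using 2 by (auto simp: descent_positions_Cons)
    ultimately show ?thesis
      unfolding has_run_lengths_Cons_Cons 2 using \<open>m > 0\<close> by (auto simp: has_run_lengths_def)
  qed
qed

text \<open>By \<open>has_run_lengths_step\<close>, the positional condition obeys the recursion of
  \<open>run_lengths\<close>. Zero parts must be excluded: \<open>has_run_lengths [] [0]\<close>
  holds.\<close>

lemma has_run_lengths_iff:
  assumes "L \<in> compositions"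
  shows "has_run_lengths u L \<longleftrightarrow> run_lengths u = L"
  using assms
proof (induction u arbitrary: L rule: run_lengths.induct)
  case (1 L)
  then show ?case
    by (cases L) (auto simp: has_run_lengths_def compositions_def)
next
  case (2 x L)
  then show ?case
    by (cases L; cases "tl L") (auto simp: has_run_lengths_def compositions_def)
next
  case (3 x y u L)
  show ?case
  proof (cases L)
    case Nil
    then show ?thesis by (auto simp: has_run_lengths_def)
  next
    case (Cons l L')
    obtain b C where bC: "run_lengths (y # u) = b # C"
      by (cases "run_lengths (y # u)") auto
    have comp: "L' \<in> compositions" "l > 0" "l \<noteq> 1 \<Longrightarrow> (l - 1) # L' \<in> compositions"
      using "3.prems"(1) Cons by (auto simp: compositions_def)
    have b: "b > 0"
      using run_lengths_in_compositions[of "y # u"] unfolding bC by (simp add: compositions_def)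
    have IH: "has_run_lengths (y # u) M \<longleftrightarrow> run_lengths (y # u) = M" if "M \<in> compositions" for M
      using "3.IH"(1,3) that by (cases "x \<le> y") auto
    show ?thesis
      unfolding Cons has_run_lengths_step[OF "3.prems"(1)[unfolded Cons]]
      using IH comp bC b by (auto simp del: run_lengths_eq_Nil_iff)
  qed
qed

section \<open>Ribbon series are noncommutative symmetric functions\<close>

lemma nc_coeff_nc_r:
  "L \<in> compositions \<Longrightarrow> nc_coeff (nc_r L) u = (if run_lengths u = L then 1 else 0)"
  by (simp add: nc_r_def has_run_lengths_iff)

lemma nc_coeff_nc_h: "nc_coeff (nc_h n) u = (if length u = n \<and> sorted u then 1 else 0)"
  by (simp add: nc_h_def)

text \<open>As \<open>nc_h a\<close> is homogeneous of degree \<open>a\<close>, only the cut after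
  \<open>a\<close> letters survives.\<close>

lemma nc_coeff_nc_h_mult:
  "nc_coeff (nc_h a * f) u =
     (if a \<le> length u \<and> sorted (take a u) then nc_coeff f (drop a u) else 0)"
proof -
  have "nc_coeff (nc_h a * f) u =
      (\<Sum>k=0..length u. if k = a then (if sorted (take a u) then nc_coeff f (drop a u) else 0) else 0)"
    unfolding times_ncfps.rep_eq nc_coeff_nc_h by (intro sum.cong) (auto simp: min_absorb2)
  then show ?thesis by auto
qed

text \<open>The left side counts words made of a weakly increasing block of length \<open>a\<close>
  followed by a word with run lengths \<open>b # L\<close>. A descent at the joint gives the first
  summand; otherwise the block merges with the run of length \<open>b\<close>.\<close>

lemma nc_h_mult_nc_r:
  assumes "a > 0" "b # L \<in> compositions"
  shows "(nc_h a * nc_r (b # L) :: 'f::field ncfps) = nc_r (a # b # L) + nc_r ((a + b) # L)"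
proof -
  have comps: "a # b # L \<in> compositions" "(a + b) # L \<in> compositions" "b > 0"
    using assms by (auto simp: compositions_def)
  have "nc_coeff (nc_h a * nc_r (b # L) :: 'f ncfps) u =
      nc_coeff (nc_r (a # b # L) + nc_r ((a + b) # L)) u" for u
  proof (cases "run_lengths u")
    case Nil
    then have "u = []" by simp
    then show ?thesis
      using comps assms by (simp add: nc_coeff_nc_h_mult nc_coeff_nc_r plus_ncfps.rep_eq)
  next
    case (Cons c C)
    have c: "c \<le> length u" using sum_list_run_lengths[of u] Cons by simp
    show ?thesis
    proof (cases "a \<le> c")
      case True
      then show ?thesis
        using c comps assms sorted_take_iff_run_lengths[OF Cons, of a] run_lengths_drop[OF Cons, of a] Cons
        by (auto simp: nc_coeff_nc_h_mult nc_coeff_nc_r plus_ncfps.rep_eq)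
    next
      \<comment> \<open>The first run is shorter than \<open>a\<close>, so the prefix of length
        \<open>a\<close>, if there is one, is not sorted; both ribbons need a first run of length at
        least \<open>a\<close>, so both sides vanish.\<close>
      case False
      then show ?thesis
        using comps assms sorted_take_iff_run_lengths[OF Cons, of a] Cons
        by (auto simp: nc_coeff_nc_h_mult nc_coeff_nc_r plus_ncfps.rep_eq)
    qed
  qed
  then show ?thesis by (simp add: ncfps_eq_iff)
qed

lemma Sym_diff: "s \<in> Sym \<Longrightarrow> t \<in> Sym \<Longrightarrow> s - t \<in> Sym"
proof -
  assume s: "s \<in> Sym" and t: "t \<in> Sym"
  have "s - t = s + Abs_ncfps (\<lambda>u. (- 1) * nc_coeff t u)"
    by (simp add: ncfps_eq_iff plus_ncfps.rep_eq minus_ncfps.rep_eq)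
  then show ?thesis using Sym_add[OF s Sym_scale[OF t]] by metis
qed

lemma nc_r_Nil: "nc_r [] = 1"
  by (simp add: ncfps_eq_iff nc_coeff_nc_r compositions_def one_ncfps.rep_eq)

lemma nc_r_single: "a > 0 \<Longrightarrow> nc_r [a] = nc_h a"
proof -
  assume a: "a > 0"
  have "run_lengths u = [a] \<longleftrightarrow> length u = a \<and> sorted u" for u :: "nat list"
  proof (cases "run_lengths u")
    case Nil
    then show ?thesis using a by auto
  next
    case (Cons c C)
    have "C = [] \<longleftrightarrow> length u \<le> c"
      using run_lengths_in_compositions[of u] sum_list_run_lengths[of u] Cons
      by (cases C) (auto simp: compositions_def)
    then show ?thesis
      using sorted_take_iff_run_lengths[OF Cons, of "length u"] sum_list_run_lengths[of u] Cons
      by auto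
  qed
  then show ?thesis using a by (simp add: ncfps_eq_iff nc_coeff_nc_r nc_coeff_nc_h compositions_def)
qed

text \<open>Solving \<open>nc_h_mult_nc_r\<close> for the ribbon with the most parts leaves two
  ribbons with one part fewer.\<close>

lemma nc_r_in_Sym: "L \<in> compositions \<Longrightarrow> (nc_r L :: 'f::field ncfps) \<in> Sym"
proof (induction "length L" arbitrary: L rule: less_induct)
  case less
  consider "L = []" | a where "L = [a]" | a b M where "L = a # b # M"
    by (metis list.exhaust)
  then show ?case
  proof cases
    case 1
    then show ?thesis by (simp add: nc_r_Nil Sym_one)
  next
    case 2
    then show ?thesis using less by (simp add: nc_r_single Sym_h compositions_def)
  next
    case 3
    have c: "a > 0" "b # M \<in> compositions" "(a + b) # M \<in> compositions"
      using less 3 by (auto simp: compositions_def)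
    have "(nc_r L :: 'f ncfps) = nc_h a * nc_r (b # M) - nc_r ((a + b) # M)"
      unfolding nc_h_mult_nc_r[OF c(1,2)] 3 by simp
    then show ?thesis
      using less c 3 by (auto intro!: Sym_diff Sym_mult Sym_h)
  qed
qed

section \<open>Infinite sums and homogeneous parts\<close>

lemma nc_coeff_sum: "nc_coeff (\<Sum>x\<in>S. f x) u = (\<Sum>x\<in>S. nc_coeff (f x) u)"
  by (induction S rule: infinite_finite_induct) (auto simp: zero_ncfps.rep_eq plus_ncfps.rep_eq)

text \<open>Evaluates both infinite sums: a word \<open>u\<close> meets only the index
  \<open>length u\<close> in the h-series and only \<open>run_lengths u\<close> in the ribbon
  series.\<close>

lemma nc_coeff_nc_sum_single:
  assumes "x \<in> I" "\<And>y. y \<in> I \<Longrightarrow> y \<noteq> x \<Longrightarrow> nc_coeff (g y) u = 0"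
  shows "nc_coeff (nc_sum g I) u = nc_coeff (g x) u"
proof -
  have "{y \<in> I. nc_coeff (g y) u \<noteq> 0} = (if nc_coeff (g x) u = 0 then {} else {x})"
    using assms by auto
  then show ?thesis by (simp add: nc_sum_def)
qed

lemma sum_in_tensor_Sym:
  assumes "finite S" "\<And>x. x \<in> S \<Longrightarrow> s x \<in> Sym"
  shows "(\<Sum>x\<in>S. nc_tensor smul (f x) (s x)) \<in> tensor_Sym smul"
proof -
  obtain xs where xs: "set xs = S" "distinct xs"
    using finite_distinct_list[OF assms(1)] by blast
  have "(\<Sum>x\<in>S. nc_tensor smul (f x) (s x)) =
      (\<Sum>(a, t)\<leftarrow>map (\<lambda>x. (f x, s x)) xs. nc_tensor smul a t)"
    by (simp add: sum_list_distinct_conv_sum_set[OF xs(2)] xs(1) comp_def)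
  then show ?thesis
    unfolding tensor_Sym_def using assms(2) xs
    by (auto intro!: exI[of _ "map (\<lambda>x. (f x, s x)) xs"])
qed

context unital_algebra
begin

lemma nc_coeff_nc_tensor: "nc_coeff (nc_tensor smul a s) u = smul (nc_coeff s u) a"
  by (simp add: nc_tensor_def)

lemma nc_coeff_sum_nc_h:
  "nc_coeff (nc_sum (\<lambda>n. nc_tensor smul (a n) (nc_h n)) UNIV) u =
     (if sorted u then a (length u) else 0)"
  by (subst nc_coeff_nc_sum_single[of "length u"]) (auto simp: nc_coeff_nc_tensor nc_coeff_nc_h)

lemma nc_coeff_sum_nc_r:
  "nc_coeff (nc_sum (\<lambda>L. nc_tensor smul (a L) (nc_r L)) compositions) u = a (run_lengths u)"
  by (subst nc_coeff_nc_sum_single[of "run_lengths u"])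
    (auto simp: nc_coeff_nc_tensor nc_coeff_nc_r run_lengths_in_compositions)

lemma sum_nc_h_in_completed:
  "nc_sum (\<lambda>n. nc_tensor smul (a n) (nc_h n)) UNIV \<in> completed_tensor_Sym smul"
proof -
  have "nc_homogeneous_part n (nc_sum (\<lambda>n. nc_tensor smul (a n) (nc_h n)) UNIV) =
      (\<Sum>k\<in>{n}. nc_tensor smul (a k) (nc_h k))" for n
    by (auto simp: ncfps_eq_iff nc_homogeneous_part_def nc_coeff_sum_nc_h nc_coeff_nc_tensor
        nc_coeff_nc_h)
  then show ?thesis
    unfolding completed_tensor_Sym_def by (auto intro: sum_in_tensor_Sym Sym_h simp del: sum.insert)
qed

lemma sum_nc_r_in_completed:
  "nc_sum (\<lambda>L. nc_tensor smul (a L) (nc_r L)) compositions \<in> completed_tensor_Sym smul"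
proof -
  have "nc_homogeneous_part n (nc_sum (\<lambda>L. nc_tensor smul (a L) (nc_r L)) compositions) =
      (\<Sum>L\<in>{L \<in> compositions. sum_list L = n}. nc_tensor smul (a L) (nc_r L))" (is "?l = ?r") for n
  proof -
    have "nc_coeff ?r u = (if length u = n then a (run_lengths u) else 0)" for u
    proof -
      have "nc_coeff ?r u = (\<Sum>L\<in>{L \<in> compositions. sum_list L = n}.
          if L = run_lengths u then a (run_lengths u) else 0)"
        by (auto simp: nc_coeff_sum nc_coeff_nc_tensor nc_coeff_nc_r intro!: sum.cong)
      then show ?thesis
        by (simp add: finite_compositions run_lengths_in_compositions sum_list_run_lengths)
    qed
    then show ?thesis
      by (simp add: ncfps_eq_iff nc_homogeneous_part_def nc_coeff_sum_nc_r)
  qed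
  then show ?thesis
    unfolding completed_tensor_Sym_def
    by (auto intro!: sum_in_tensor_Sym nc_r_in_Sym finite_compositions)
qed

end

section \<open>Weights of walks in a run network\<close>

context run_network
begin

lemma labelled_walks_ConsI:
  "(a, (i, k)) \<in> labelled_arcs G P \<Longrightarrow> \<beta> \<in> labelled_walks G P k j \<Longrightarrow>
     (a, (i, k)) # \<beta> \<in> labelled_walks G P i j"
  by (auto simp: labelled_walks_def labelled_arcs_def awalk_Cons_iff)

lemma labelled_walks_ConsE:
  assumes "x # \<beta> \<in> labelled_walks G P i j"
  obtains k where "snd x = (i, k)" "x \<in> labelled_arcs G P" "\<beta> \<in> labelled_walks G P k j"
  using assms by (cases x) (auto simp: labelled_walks_def awalk_Cons_iff)

lemma run_weight_eq_prod_list: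
  assumes "\<alpha> \<in> labelled_walks G P i j"
  shows "run_weight G P w i j (map fst \<alpha>) = (\<Prod>(a, e)\<leftarrow>\<alpha>. w a e)"
proof -
  have "(THE \<beta>. \<beta> \<in> labelled_walks G P i j \<and> map fst \<beta> = map fst \<alpha>) = \<alpha>"
  proof (rule the_equality)
    fix \<beta> assume "\<beta> \<in> labelled_walks G P i j \<and> map fst \<beta> = map fst \<alpha>"
    then show "\<beta> = \<alpha>"
      using labels_determine_walk[of \<beta> \<alpha> i j] assms
      by (cases "\<beta> = []"; cases "\<alpha> = []") auto
  qed (use assms in simp)
  then show ?thesis unfolding run_weight_def using assms by auto
qed

lemma run_weight_nonzeroE:
  assumes "run_weight G P w i j L \<noteq> 0"
  obtains \<alpha> where "\<alpha> \<in> labelled_walks G P i j" "map fst \<alpha> = L"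
  using assms by (auto simp: run_weight_def split: if_splits)

text \<open>At most one summand is nonzero: each nonzero one produces a walk from \<open>i\<close>
  to \<open>j\<close> with labels \<open>a # L\<close>, and such a walk is unique. This turns run
  weights into entries of matrix products.\<close>

lemma run_weight_Cons:
  assumes zero: "\<And>a e. (a, e) \<notin> labelled_arcs G P \<Longrightarrow> w a e = 0"
  shows "run_weight G P w i j (a # L) = (\<Sum>k\<in>UNIV. w a (i, k) * run_weight G P w k j L)"
proof (cases "\<exists>\<alpha> \<in> labelled_walks G P i j. map fst \<alpha> = a # L")
  case True
  then obtain e \<beta> where e: "(a, e) # \<beta> \<in> labelled_walks G P i j" "map fst \<beta> = L"
    by (metis (no_types, lifting) map_eq_Cons_conv prod.collapse)
  obtain k where k: "e = (i, k)" "\<beta> \<in> labelled_walks G P k j"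
    using labelled_walks_ConsE[OF e(1)] by (metis snd_conv)
  have "w a (i, l) * run_weight G P w l j L = 0" if "l \<noteq> k" for l
  proof (rule ccontr)
    assume nz: "w a (i, l) * run_weight G P w l j L \<noteq> 0"
    then obtain \<gamma> where \<gamma>: "\<gamma> \<in> labelled_walks G P l j" "map fst \<gamma> = L"
      by (metis mult_zero_right run_weight_nonzeroE)
    \<comment> \<open>Weights vanish off the labelled arcs, so a nonzero factor certifies its
      arc.\<close>
    have "(a, (i, l)) \<in> labelled_arcs G P" using nz zero by fastforce
    from labelled_walks_ConsI[OF this \<gamma>(1)] have "(a, (i, l)) # \<gamma> = (a, e) # \<beta>"
      using e \<gamma> by (intro labels_determine_walk[of _ _ i j]) auto
    then show False using that k by simp
  qed
  then have "(\<Sum>l\<in>UNIV. w a (i, l) * run_weight G P w l j L) = w a (i, k) * run_weight G P w k j L"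
    by (subst sum.remove[of _ k]) (auto intro!: sum.neutral)
  also have "\<dots> = run_weight G P w i j (a # L)"
    using run_weight_eq_prod_list[OF e(1), of w] run_weight_eq_prod_list[OF k(2), of w] e(2) k(1) by simp
  finally show ?thesis by simp
next
  case False
  have "w a (i, l) * run_weight G P w l j L = 0" for l
  proof (rule ccontr)
    assume nz: "w a (i, l) * run_weight G P w l j L \<noteq> 0"
    then obtain \<gamma> where \<gamma>: "\<gamma> \<in> labelled_walks G P l j" "map fst \<gamma> = L"
      by (metis mult_zero_right run_weight_nonzeroE)
    have "(a, (i, l)) \<in> labelled_arcs G P" using nz zero by fastforce
    from labelled_walks_ConsI[OF this \<gamma>(1)] show False using False \<gamma> by force
  qed
  then show ?thesis using False by (simp add: run_weight_def)
qed

end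

section \<open>Matrices of power series\<close>

text \<open>\<open>matrix_inv\<close> is a Hilbert choice; the witness \<open>B\<close> makes the
  chosen matrix a two-sided inverse, and such inverses are unique.\<close>

lemma matrix_inv_eqI:
  fixes A :: "'a::semiring_1 ^ 'n ^ 'n"
  assumes "A ** B = mat 1" "B ** A = mat 1"
  shows "matrix_inv A = B"
proof -
  have "A ** matrix_inv A = mat 1 \<and> matrix_inv A ** A = mat 1"
    unfolding matrix_inv_def by (rule someI[of _ B]) (use assms in simp)
  then have "matrix_inv A = matrix_inv A ** (A ** B)" "matrix_inv A ** A = mat 1"
    using assms by simp_all
  then show ?thesis by (simp add: matrix_mul_assoc)
qed

text \<open>Over a noncommutative ring \<open>A ** B = mat 1\<close> need not give
  \<open>B ** A = mat 1\<close>; it does once \<open>B\<close> has a right inverse too, which this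
  identifies with \<open>A\<close>.\<close>

lemma matrix_left_right_inverse_eq:
  fixes A :: "'a::semiring_1 ^ 'n ^ 'n"
  assumes "A ** B = mat 1" "B ** C = mat 1"
  shows "A = C"
  by (metis assms matrix_mul_assoc matrix_mul_lid matrix_mul_rid)

lemma matrix_mult_sum_left:
  "(\<Sum>k\<in>S. A k) ** B = (\<Sum>k\<in>S. A k ** (B :: 'a::ring_1 ^ 'n ^ 'm))"
  by (simp add: vec_eq_iff matrix_matrix_mult_def sum_distrib_right sum.swap[of _ UNIV])

text \<open>Turns a matrix of series into a series with matrix coefficients, so that products become
  convolutions over the cuts of a word.\<close>

definition nc_coeff_matrix :: "'a ncfps ^ 'n ^ 'm \<Rightarrow> nat list \<Rightarrow> 'a ^ 'n ^ 'm" where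
  "nc_coeff_matrix M u = (\<chi> i j. nc_coeff (M $ i $ j) u)"

lemma ncfps_matrix_eq_iff: "M = N \<longleftrightarrow> (\<forall>u. nc_coeff_matrix M u = nc_coeff_matrix N u)"
  by (auto simp: nc_coeff_matrix_def vec_eq_iff ncfps_eq_iff)

lemma nc_coeff_matrix_mat_1: "nc_coeff_matrix (mat 1) u = (if u = [] then mat 1 else 0)"
  by (auto simp: nc_coeff_matrix_def vec_eq_iff mat_def one_ncfps.rep_eq zero_ncfps.rep_eq)

lemma nc_coeff_matrix_mult:
  "nc_coeff_matrix (M ** N) u =
     (\<Sum>k=0..length u. nc_coeff_matrix M (take k u) ** nc_coeff_matrix N (drop k u))"
  by (simp add: nc_coeff_matrix_def vec_eq_iff matrix_matrix_mult_def nc_coeff_sum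
      times_ncfps.rep_eq sum.swap[of _ UNIV])

definition fps_nth_matrix :: "'a fps ^ 'n ^ 'm \<Rightarrow> nat \<Rightarrow> 'a ^ 'n ^ 'm" where
  "fps_nth_matrix M k = (\<chi> i j. fps_nth (M $ i $ j) k)"

lemma fps_matrix_eq_iff: "M = N \<longleftrightarrow> (\<forall>k. fps_nth_matrix M k = fps_nth_matrix N k)"
  by (auto simp: fps_nth_matrix_def vec_eq_iff fps_eq_iff)

lemma fps_nth_matrix_mat_1: "fps_nth_matrix (mat 1) k = (if k = 0 then mat 1 else 0)"
  by (auto simp: fps_nth_matrix_def vec_eq_iff mat_def)

lemma fps_nth_matrix_mult:
  fixes M N :: "'a::ring_1 fps ^ 'n ^ 'n"
  shows "fps_nth_matrix (M ** N) n = (\<Sum>k=0..n. fps_nth_matrix M k ** fps_nth_matrix N (n - k))"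
  by (simp add: fps_nth_matrix_def vec_eq_iff matrix_matrix_mult_def fps_sum_nth
      fps_mult_nth sum.swap[of _ UNIV])

text \<open>Solves the convolution equation for a right inverse when the constant coefficient is
  \<open>mat 1\<close>: the cut \<open>k = 0\<close> contributes the unknown itself, and the cuts
  from 1 on involve shorter suffixes.\<close>

function nc_inverse_coeff :: "(nat list \<Rightarrow> 'a::ring_1 ^ 'n ^ 'n) \<Rightarrow> nat list \<Rightarrow> 'a ^ 'n ^ 'n" where
  "nc_inverse_coeff c u = (if u = [] then mat 1
     else - (\<Sum>k=1..length u. c (take k u) ** nc_inverse_coeff c (drop k u)))"
  by auto
termination by (relation "measure (\<lambda>(c, u). length u)") auto

declare nc_inverse_coeff.simps [simp del]

lemma ncfps_matrix_right_inverse: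
  fixes M :: "'a::ring_1 ncfps ^ 'n ^ 'n"
  assumes "nc_coeff_matrix M [] = mat 1"
  shows "\<exists>X. M ** X = mat 1"
proof
  let ?x = "nc_inverse_coeff (nc_coeff_matrix M)"
  define X :: "'a ncfps ^ 'n ^ 'n" where "X = (\<chi> i j. Abs_ncfps (\<lambda>u. ?x u $ i $ j))"
  have X: "nc_coeff_matrix X u = ?x u" for u
    by (simp add: X_def nc_coeff_matrix_def)
  have "nc_coeff_matrix (M ** X) u = nc_coeff_matrix (mat 1) u" for u
  proof (cases "u = []")
    case True
    then show ?thesis
      using assms by (simp add: nc_coeff_matrix_mult nc_coeff_matrix_mat_1 X nc_inverse_coeff.simps)
  next
    case False
    have "nc_coeff_matrix (M ** X) u =
        ?x u + (\<Sum>k=1..length u. nc_coeff_matrix M (take k u) ** ?x (drop k u))"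
      unfolding nc_coeff_matrix_mult X by (simp add: sum.atLeast_Suc_atMost assms)
    also have "\<dots> = 0"
      by (subst nc_inverse_coeff.simps) (simp add: False)
    finally show ?thesis by (simp add: nc_coeff_matrix_mat_1 False)
  qed
  then show "M ** X = mat 1" by (simp add: ncfps_matrix_eq_iff)
qed

function fps_inverse_coeff :: "(nat \<Rightarrow> 'a::ring_1 ^ 'n ^ 'n) \<Rightarrow> nat \<Rightarrow> 'a ^ 'n ^ 'n" where
  "fps_inverse_coeff c n = (if n = 0 then mat 1
     else - (\<Sum>k=1..n. c k ** fps_inverse_coeff c (n - k)))"
  by auto
termination by (relation "measure (\<lambda>(c, n). n)") auto

declare fps_inverse_coeff.simps [simp del]

text \<open>The constant term of \<open>X\<close> is recorded so that the lemma applies to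
  \<open>X\<close> in turn, which makes the inverse two-sided.\<close>

lemma fps_matrix_right_inverse:
  fixes M :: "'a::ring_1 fps ^ 'n ^ 'n"
  assumes "fps_nth_matrix M 0 = mat 1"
  shows "\<exists>X. M ** X = mat 1 \<and> fps_nth_matrix X 0 = mat 1"
proof (intro exI conjI)
  let ?x = "fps_inverse_coeff (fps_nth_matrix M)"
  define X :: "'a fps ^ 'n ^ 'n" where "X = (\<chi> i j. Abs_fps (\<lambda>n. ?x n $ i $ j))"
  have X: "fps_nth_matrix X n = ?x n" for n
    by (simp add: X_def fps_nth_matrix_def)
  show "fps_nth_matrix X 0 = mat 1" by (simp add: X fps_inverse_coeff.simps)
  have "fps_nth_matrix (M ** X) n = fps_nth_matrix (mat 1) n" for n
  proof (cases "n = 0")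
    case True
    then show ?thesis
      using assms by (simp add: fps_nth_matrix_mult fps_nth_matrix_mat_1 X fps_inverse_coeff.simps)
  next
    case False
    have "fps_nth_matrix (M ** X) n = ?x n + (\<Sum>k=1..n. fps_nth_matrix M k ** ?x (n - k))"
      unfolding fps_nth_matrix_mult X by (simp add: sum.atLeast_Suc_atMost assms)
    also have "\<dots> = 0"
      by (subst fps_inverse_coeff.simps) (simp add: False)
    finally show ?thesis by (simp add: fps_nth_matrix_mat_1 False)
  qed
  then show "M ** X = mat 1" by (simp add: fps_matrix_eq_iff)
qed

lemma fps_matrix_inv_left:
  fixes M :: "'a::ring_1 fps ^ 'n ^ 'n"
  assumes "fps_nth_matrix M 0 = mat 1"
  shows "matrix_inv M ** M = mat 1"
proof -
  obtain X where X: "M ** X = mat 1" "fps_nth_matrix X 0 = mat 1"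
    using fps_matrix_right_inverse[OF assms] by blast
  obtain Y where Y: "X ** Y = mat 1"
    using fps_matrix_right_inverse[OF X(2)] by blast
  have "X ** M = mat 1" using Y matrix_left_right_inverse_eq[OF X(1) Y] by simp
  then show ?thesis using matrix_inv_eqI[OF X(1)] by simp
qed

theorem theorem2:
  fixes smul :: "'f::field_char_0 \<Rightarrow> 'a::ring_1 \<Rightarrow> 'a"
    and G :: "'v::finite pair_pre_digraph"
    and P :: "'v \<times> 'v \<Rightarrow> nat set"
    and w :: "nat \<Rightarrow> 'v \<times> 'v \<Rightarrow> 'a"
    and v :: "nat \<Rightarrow> 'v \<Rightarrow> 'v \<Rightarrow> 'a"
    and R H :: "'a ncfps ^ 'v ^ 'v"
  assumes "unital_algebra smul"
    and "run_network G P"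
    and "\<And>a e. (a, e) \<notin> labelled_arcs G P \<Longrightarrow> w a e = 0"
    and "(\<chi> i j. Abs_fps (\<lambda>n. v n i j)) =
         matrix_inv (mat 1 + (\<chi> i j. Abs_fps (\<lambda>k. if k \<ge> 1 then w k (i, j) else 0)))"
    and "R = (\<chi> i j. nc_sum (\<lambda>L. nc_tensor smul (run_weight G P w i j L) (nc_r L)) compositions)"
    and "H = (\<chi> i j. nc_sum (\<lambda>n. nc_tensor smul (v n i j) (nc_h n)) UNIV)"
  shows "(\<forall>i j. R $ i $ j \<in> completed_tensor_Sym smul) \<and>
         (\<forall>i j. H $ i $ j \<in> completed_tensor_Sym smul) \<and>
         invertible H \<and> R = matrix_inv H"
proof -
  interpret unital_algebra smul by fact
  interpret run_network G P by fact
  define V :: "nat \<Rightarrow> 'a ^ 'v ^ 'v" where "V n = (\<chi> i j. v n i j)" for n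
  \<comment> \<open>\<open>W 0\<close> is the constant term of the matrix to be inverted, not the
    weights of a label 0; hence \<open>a > 0\<close> in \<open>\<Omega>_Cons\<close>.\<close>
  define W :: "nat \<Rightarrow> 'a ^ 'v ^ 'v" where
    "W n = (if n = 0 then mat 1 else (\<chi> i j. w n (i, j)))" for n
  define \<Omega> :: "nat list \<Rightarrow> 'a ^ 'v ^ 'v" where "\<Omega> L = (\<chi> i j. run_weight G P w i j L)" for L
  let ?V = "\<chi> i j. Abs_fps (\<lambda>n. v n i j)"
  let ?M = "mat 1 + (\<chi> i j. Abs_fps (\<lambda>k. if k \<ge> 1 then w k (i, j) else 0)) :: 'a fps ^ 'v ^ 'v"
  have M: "fps_nth_matrix ?M n = W n" for n
    by (auto simp: W_def fps_nth_matrix_def vec_eq_iff mat_def)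
  have "fps_nth_matrix (?V ** ?M) n = (\<Sum>k=0..n. V k ** W (n - k))" for n
    unfolding fps_nth_matrix_mult M by (simp add: V_def fps_nth_matrix_def)
  \<comment> \<open>The order matters: \<open>V\<close> must stand on the left, as \<open>H\<close>
    does in \<open>H ** R\<close>.\<close>
  moreover have "?V ** ?M = mat 1"
    unfolding assms(4) by (rule fps_matrix_inv_left) (simp only: M W_def refl if_True)
  ultimately have VW: "(\<Sum>k=0..n. V k ** W (n - k)) = (if n = 0 then mat 1 else 0)" for n
    by (metis fps_nth_matrix_mat_1)

  have \<Omega>_Nil: "\<Omega> [] = mat 1"
    by (simp add: \<Omega>_def vec_eq_iff mat_def run_weight_Nil)
  have \<Omega>_Cons: "\<Omega> (a # L) = W a ** \<Omega> L" if "a > 0" for a L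
    using that run_weight_Cons[OF assms(3)]
    by (simp add: \<Omega>_def W_def vec_eq_iff matrix_matrix_mult_def)

  have R: "nc_coeff_matrix R u = \<Omega> (run_lengths u)" for u
    by (simp add: nc_coeff_matrix_def \<Omega>_def assms(5) nc_coeff_sum_nc_r)
  have H: "nc_coeff_matrix H u = (if sorted u then V (length u) else 0)" for u
    by (simp add: nc_coeff_matrix_def V_def assms(6) nc_coeff_sum_nc_h vec_eq_iff)

  have "nc_coeff_matrix (H ** R) u = nc_coeff_matrix (mat 1) u" for u
  proof (cases "run_lengths u")
    case Nil
    then have "u = []" by simp
    then show ?thesis
      using VW[of 0] by (simp add: nc_coeff_matrix_mult nc_coeff_matrix_mat_1 R H \<Omega>_Nil W_def)
  next
    case (Cons a L)
    have a: "a > 0" "a \<le> length u"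
      using run_lengths_in_compositions[of u] sum_list_run_lengths[of u] Cons
      by (auto simp: compositions_def)
    have "nc_coeff_matrix (H ** R) u =
        (\<Sum>k=0..length u. if k \<le> a then V k ** \<Omega> (run_lengths (drop k u)) else 0)"
      unfolding nc_coeff_matrix_mult R H
      by (intro sum.cong)
        (auto simp: sorted_take_iff_run_lengths[OF Cons] min_absorb2 matrix_matrix_mult_def vec_eq_iff)
    also have "\<dots> = (\<Sum>k=0..a. V k ** \<Omega> (run_lengths (drop k u)))"
      using a by (intro sum.mono_neutral_cong_right) auto
    \<comment> \<open>For \<open>k < a\<close> the suffix begins with a run of length
      \<open>a - k\<close>; for \<open>k = a\<close> its run lengths are \<open>L\<close>, and
      \<open>W 0 = mat 1\<close> gives the same formula.\<close>
    also have "\<dots> = (\<Sum>k=0..a. V k ** W (a - k) ** \<Omega> L)"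
      using \<Omega>_Cons
      by (intro sum.cong)
        (auto simp: run_lengths_drop[OF Cons] matrix_mul_assoc[symmetric] W_def)
    also have "\<dots> = (\<Sum>k=0..a. V k ** W (a - k)) ** \<Omega> L"
      by (simp add: matrix_mult_sum_left)
    also have "\<dots> = 0"
      unfolding VW using a by (simp add: matrix_matrix_mult_def vec_eq_iff)
    finally show ?thesis using Cons by (auto simp: nc_coeff_matrix_mat_1)
  qed
  then have HR: "H ** R = mat 1" by (simp add: ncfps_matrix_eq_iff)
  \<comment> \<open>The constant coefficient of \<open>R\<close> is
    \<open>\<Omega> [] = mat 1\<close>, so \<open>R\<close> has a right inverse, which must then be
    \<open>H\<close>.\<close>
  obtain X where X: "R ** X = mat 1"
    using ncfps_matrix_right_inverse[of R] by (auto simp: R \<Omega>_Nil)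
  have RH: "R ** H = mat 1" using X matrix_left_right_inverse_eq[OF HR X] by simp
  show ?thesis
  proof (intro conjI allI)
    show "R $ i $ j \<in> completed_tensor_Sym smul" for i j
      by (simp add: assms(5) sum_nc_r_in_completed)
    show "H $ i $ j \<in> completed_tensor_Sym smul" for i j
      by (simp add: assms(6) sum_nc_h_in_completed)
    show "invertible H" using HR RH by (auto simp: invertible_def)
    show "R = matrix_inv H" using matrix_inv_eqI[OF HR RH] by simp
  qed
qed

end
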